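(* Fix an access point $m$ and consider any two devices $n$ and $n'$ with signature sequences $\mathbf{s}_n,\mathbf{s}_{n'}\in\mathbb{C}^L$. Let $$\rho_{n,n'}=\frac{\boldsymbol{\psi}_{m,n}^{\mathrm H}\boldsymbol{\psi}_{m,n'}}{\|\boldsymbol{\psi}_{m,n}\|_2\,\|\boldsymbol{\psi}_{m,n'}\|_2},\qquad \boldsymbol{\psi}_{m,q}=\mathrm{vec}\big(\mathbf{\Xi}_{m,q}\otimes(\mathbf{s}_q\mathbf{s}_q^{\mathrm H})\big),\quad q\in\{n,n'\},$$ be the cosine similarity between $\boldsymbol{\psi}_{m,n}$ and $\boldsymbol{\psi}_{m,n'}$, where $\mathbf{\Xi}_{m,q}$ is the channel covariance matrix of device $q$ at access point $m$ (see context). Let $\rho_{\text{FF-FF}}$, $\rho_{\text{NF-NF}}$ and $\rho_{\text{NF-FF}}$ denote the value of $\rho_{n,n'}$ (for the same signature sequences) when, respectively, both devices are far-field devices of access point $m$, both are near-field devices, and one is a near-field device while the other is a far-field device. Then $$\rho_{\text{NF-NF}}\le\rho_{\text{FF-FF}},\qquad \rho_{\text{NF-FF}}<\rho_{\text{FF-FF}}.$$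
   Context: $K$ is the number of antennas of access point $m$ and $L$ the signature length; each device is pre-assigned a distinct signature sequence in $\mathbb{C}^L$; $\otimes$ is the Kronecker product, $\mathrm{vec}$ the column-stacking vectorization, and $^{\mathrm H}$ the conjugate transpose. The matrix $\mathbf{\Xi}_{m,q}$ is the $K\times K$ channel covariance matrix of device $q$ at access point $m$: - if $q$ is a far-field device, $\mathbf{\Xi}_{m,q}=g_{m,q}\mathbf{I}_K$, where $g_{m,q}>0$ is the large-scale fading coefficient; - if $q$ is a near-field device, $\mathbf{\Xi}_{m,q}=\mathbf{R}_{m,q}=\sum_{\ell=1}^{L_m}\sigma_{m,\ell}^2\,|\tilde\beta_{m,q,\ell}|^2\,\mathbf{b}(\tilde{\mathbf{r}}_{m,\ell})\mathbf{b}(\tilde{\mathbf{r}}_{m,\ell})^{\mathrm H}$, where $L_m$ is the number of scatterers, $\sigma_{m,\ell}^2$ are the variances of the reflection coefficients, $\tilde\beta_{m,q,\ell}$ are channel gains, $\tilde{\mathbf{r}}_{m,\ell}\in\mathbb{R}^K$ is the vector of distances between scatterer $\ell$ and the $K$ antennas, and $\mathbf{b}(\mathbf{r})=[e^{-j2\pi r_1/\lambda_{\mathrm c}},\dots,e^{-j2\pi r_K/\lambda_{\mathrm c}}]^{\mathrm T}$ with wavelength $\lambda_{\mathrm c}>0$. Standing assumption: each near-field covariance matrix $\mathbf{R}_{m,q}$ is not a diagonal matrix.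
   Formalization: The strict inequality ρ_NF-FF < ρ_FF-FF is asserted only when s_n^H s_n' ≠ 0: for orthogonal signatures all three values of ρ are 0, so the strict claim fails; there only ρ_NF-FF ≤ ρ_FF-FF is stated. *)

theory Defs
  imports "HOL-Analysis.Analysis"
begin

definition outer_prod :: "complex ^ 'n \<Rightarrow> complex ^ 'm \<Rightarrow> complex ^ 'm ^ 'n" where
  "outer_prod v w = (\<chi> i j. v $ i * cnj (w $ j))"

definition kronecker ::
  "complex ^ 'n ^ 'm \<Rightarrow> complex ^ 'q ^ 'p \<Rightarrow> complex ^ ('n \<times> 'q) ^ ('m \<times> 'p)" where
  "kronecker A B = (\<chi> i j. A $ fst i $ fst j * B $ snd i $ snd j)"

(* Column stacking: the entry in row i and column j sits at position (j, i), so that the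
   lexicographic order on positions runs through the matrix column by column. *)
definition vectorize :: "complex ^ 'n ^ 'm \<Rightarrow> complex ^ ('n \<times> 'm)" where
  "vectorize A = (\<chi> p. A $ snd p $ fst p)"

(* v^H w, conjugate-linear in the first argument; the library inner product on
   complex vectors is only its real part. *)
definition herm_inner :: "complex ^ 'n \<Rightarrow> complex ^ 'n \<Rightarrow> complex" where
  "herm_inner v w = (\<Sum>i\<in>UNIV. cnj (v $ i) * w $ i)"

(* norm on complex ^ 'n is the Euclidean norm. The quotient is 0 if a vector vanishes. *)
definition cosine_similarity :: "complex ^ 'n \<Rightarrow> complex ^ 'n \<Rightarrow> complex" where
  "cosine_similarity v w = herm_inner v w / complex_of_real (norm v * norm w)"

definition is_diagonal :: "complex ^ 'n ^ 'n \<Rightarrow> bool" where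
  "is_diagonal A \<longleftrightarrow> (\<forall>i j. i \<noteq> j \<longrightarrow> A $ i $ j = 0)"

definition steering :: "real \<Rightarrow> real ^ 'k \<Rightarrow> complex ^ 'k" where
  "steering lam r = (\<chi> k. exp (- (\<i> * complex_of_real (2 * pi * (r $ k) / lam))))"

(* The data of a device that determine its channel to the fixed access point: the large-scale
   fading coefficient of a far-field device, or the channel gains of a near-field device,
   indexed by scatterers. *)
datatype channel =
    is_far: Far_Field (fading: real)
  | is_near: Near_Field (gains: "nat \<Rightarrow> complex")

(* The parameters of the access point: wavelength lam, number Lm of scatterers, standard
   deviations sd of their reflection coefficients, distances r from the scatterers to the
   antennas, which are indexed by 'k. *)
primrec channel_cov ::
  "real \<Rightarrow> nat \<Rightarrow> (nat \<Rightarrow> real) \<Rightarrow> (nat \<Rightarrow> real ^ 'k) \<Rightarrow> channel \<Rightarrow> complex ^ 'k ^ 'k" where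
  "channel_cov lam Lm sd r (Far_Field g) = g *\<^sub>R mat 1"
| "channel_cov lam Lm sd r (Near_Field b) =
     (\<Sum>l=1..Lm. ((sd l)\<^sup>2 * (cmod (b l))\<^sup>2) *\<^sub>R
        outer_prod (steering lam (r l)) (steering lam (r l)))"

primrec admissible ::
  "real \<Rightarrow> nat \<Rightarrow> (nat \<Rightarrow> real) \<Rightarrow> (nat \<Rightarrow> real ^ 'k) \<Rightarrow> channel \<Rightarrow> bool" where
  "admissible lam Lm sd r (Far_Field g) \<longleftrightarrow> g > 0"
| "admissible lam Lm sd r (Near_Field b) \<longleftrightarrow>
     \<not> is_diagonal (channel_cov lam Lm sd r (Near_Field b))"

definition psi :: "complex ^ 'k ^ 'k \<Rightarrow> complex ^ 'l \<Rightarrow> complex ^ (('k \<times> 'l) \<times> ('k \<times> 'l))" where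
  "psi X s = vectorize (kronecker X (outer_prod s s))"

definition rho :: "complex ^ 'k ^ 'k \<Rightarrow> complex ^ 'l \<Rightarrow> complex ^ 'k ^ 'k \<Rightarrow> complex ^ 'l \<Rightarrow> complex" where
  "rho X s X' s' = cosine_similarity (psi X s) (psi X' s')"

end

theory Submission
  imports Defs
begin

text \<open>
  The cosine similarity of two vectors \<open>vec (X \<otimes> s s\<^sup>H)\<close> factors into the cosine of the angle between
  the covariance matrices \<open>X\<close> and \<open>X'\<close> in the Frobenius inner product and the squared normalised
  correlation of the signatures. The second factor does not depend on the kind of the devices. The
  first one equals 1 for two far-field devices (both matrices are positive multiples of the identity)
  and is at most 1 by the Cauchy-Schwarz inequality. Equality in the mixed case would make the
  near-field covariance matrix a multiple of the identity, hence diagonal.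
\<close>

text \<open>Shared by both kinds of covariance matrix. It makes their complex Frobenius product
  real, so that \<open>\<bullet>\<close>, in general only the real part of that product, is all of
  it.\<close>

definition hermitian :: "complex ^ 'n ^ 'n \<Rightarrow> bool" where
  "hermitian A \<longleftrightarrow> (\<forall>i j. A $ j $ i = cnj (A $ i $ j))"

lemma hermitian_outer_prod: "hermitian (outer_prod v v)"
  by (simp add: hermitian_def outer_prod_def)

lemma hermitian_scaleR: "hermitian A \<Longrightarrow> hermitian (c *\<^sub>R A)"
  unfolding hermitian_def by (metis complex_cnj_scaleR vector_scaleR_component)

lemma hermitian_sum:
  assumes "\<And>i. i \<in> I \<Longrightarrow> hermitian (A i)"
  shows "hermitian (\<Sum>i\<in>I. A i)"
  unfolding hermitian_def sum_component cnj_sum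
  by (intro allI sum.cong refl) (metis assms hermitian_def)

lemma hermitian_mat_1: "hermitian (mat 1)"
  by (simp add: hermitian_def mat_def)

lemma hermitian_channel_cov: "hermitian (channel_cov lam Lm sd r c)"
  by (cases c) (auto intro!: hermitian_sum hermitian_scaleR hermitian_outer_prod hermitian_mat_1)

text \<open>Conjugating the summands transposes both matrices, and swapping the two sums undoes
  this, so the sum is its own conjugate.\<close>

lemma sum_cnj_mult_hermitian:
  assumes "hermitian A" and "hermitian B"
  shows "(\<Sum>i\<in>UNIV. \<Sum>j\<in>UNIV. cnj (A $ i $ j) * B $ i $ j) = complex_of_real (A \<bullet> B)"
    (is "?S = _")
proof (rule complex_eqI)
  show "Re ?S = Re (complex_of_real (A \<bullet> B))"
    by (simp add: inner_vec_def inner_complex_def)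
  have "cnj ?S = (\<Sum>i\<in>UNIV. \<Sum>j\<in>UNIV. cnj (A $ j $ i) * B $ j $ i)"
    unfolding cnj_sum complex_cnj_mult
    by (intro sum.cong refl) (metis assms hermitian_def)
  also have "\<dots> = ?S"
    by (rule sum.swap)
  finally show "Im ?S = Im (complex_of_real (A \<bullet> B))"
    by (simp only: Reals_cnj_iff [symmetric] complex_is_Real_iff Im_complex_of_real)
qed

lemma herm_inner_self: "herm_inner v v = complex_of_real ((norm v)\<^sup>2)"
proof -
  have "herm_inner v v = complex_of_real (v \<bullet> v)"
    by (simp only: herm_inner_def inner_vec_def of_real_sum complex_norm_square mult.commute
        flip: power2_norm_eq_inner)
  then show ?thesis
    by (simp add: power2_norm_eq_inner)
qed

text \<open>The Frobenius product of Kronecker products is the product of the Frobenius products of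
  the factors, and the rank-one matrices \<open>s s\<^sup>H\<close> and \<open>t t\<^sup>H\<close>
  contribute the squared modulus of \<open>herm_inner s t\<close>.\<close>

lemma herm_inner_psi:
  assumes "hermitian X" and "hermitian Y"
  shows "herm_inner (psi X s) (psi Y t) =
    complex_of_real ((X \<bullet> Y) * (cmod (herm_inner s t))\<^sup>2)"
proof -
  \<comment> \<open>Vectorization puts the column index \<open>(k, l)\<close> before the row index
    \<open>(k', l')\<close>, hence the entries \<open>X $ k' $ k\<close> and the later swaps of
    sums.\<close>
  have "herm_inner (psi X s) (psi Y t) =
      (\<Sum>k\<in>UNIV. \<Sum>l\<in>UNIV. \<Sum>k'\<in>UNIV. \<Sum>l'\<in>UNIV.
        (cnj (X $ k' $ k) * Y $ k' $ k) * ((cnj (s $ l') * t $ l') * (s $ l * cnj (t $ l))))"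
    by (simp add: herm_inner_def psi_def vectorize_def kronecker_def outer_prod_def
        UNIV_Times_UNIV [symmetric] sum.cartesian_product' mult_ac del: UNIV_Times_UNIV)
  also have "\<dots> = (\<Sum>k\<in>UNIV. \<Sum>k'\<in>UNIV. \<Sum>l\<in>UNIV. \<Sum>l'\<in>UNIV.
        (cnj (X $ k' $ k) * Y $ k' $ k) * ((cnj (s $ l') * t $ l') * (s $ l * cnj (t $ l))))"
    by (intro sum.cong refl sum.swap)
  also have "\<dots> = (\<Sum>k\<in>UNIV. \<Sum>k'\<in>UNIV. cnj (X $ k' $ k) * Y $ k' $ k) *
      (\<Sum>l\<in>UNIV. \<Sum>l'\<in>UNIV. (cnj (s $ l') * t $ l') * (s $ l * cnj (t $ l)))"
    by (simp only: sum_distrib_right, simp only: sum_distrib_left)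
  also have "(\<Sum>l\<in>UNIV. \<Sum>l'\<in>UNIV. (cnj (s $ l') * t $ l') * (s $ l * cnj (t $ l))) =
      herm_inner s t * cnj (herm_inner s t)"
    by (subst sum.swap) (simp add: herm_inner_def sum_product)
  also have "(\<Sum>k\<in>UNIV. \<Sum>k'\<in>UNIV. cnj (X $ k' $ k) * Y $ k' $ k) = complex_of_real (X \<bullet> Y)"
    by (subst sum.swap) (rule sum_cnj_mult_hermitian [OF assms])
  finally show ?thesis
    by (simp flip: complex_norm_square)
qed

lemma norm_psi:
  assumes "hermitian X"
  shows "norm (psi X s) = norm X * (norm s)\<^sup>2"
proof -
  have "complex_of_real ((norm (psi X s))\<^sup>2) = complex_of_real ((X \<bullet> X) * ((norm s)\<^sup>2)\<^sup>2)"
    using herm_inner_psi [OF assms assms, of s s]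
    by (simp only: herm_inner_self norm_of_real abs_power2 abs_norm_cancel)
  also have "\<dots> = complex_of_real ((norm X * (norm s)\<^sup>2)\<^sup>2)"
    by (simp only: power_mult_distrib power2_norm_eq_inner)
  finally have "(norm (psi X s))\<^sup>2 = (norm X * (norm s)\<^sup>2)\<^sup>2"
    by (simp only: of_real_eq_iff)
  then show ?thesis
    by (simp add: power2_eq_iff_nonneg)
qed

text \<open>If a norm vanishes, both sides are 0 by the convention \<open>x / 0 = 0\<close>.\<close>

lemma rho_hermitian:
  assumes "hermitian X" and "hermitian Y"
  shows "rho X s Y t = complex_of_real
    ((X \<bullet> Y) / (norm X * norm Y) * (cmod (herm_inner s t) / (norm s * norm t))\<^sup>2)"
  by (simp add: rho_def cosine_similarity_def herm_inner_psi norm_psi assms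
      power_divide power_mult_distrib mult_ac)

lemma real_cosine_le_1:
  fixes x y :: "'a::real_inner"
  shows "(x \<bullet> y) / (norm x * norm y) \<le> 1"
  using norm_cauchy_schwarz [of x y] by (auto simp: divide_le_eq_1 zero_less_mult_iff)

lemma real_cosine_scaleR:
  fixes x :: "'a::real_inner"
  assumes "x \<noteq> 0" and "a > 0" and "b > 0"
  shows "((a *\<^sub>R x) \<bullet> (b *\<^sub>R x)) / (norm (a *\<^sub>R x) * norm (b *\<^sub>R x)) = 1"
  using assms by (simp add: power2_norm_eq_inner [symmetric] power2_eq_square)

lemma real_cosine_mat_1_less_1:
  fixes X :: "complex ^ 'k ^ 'k"
  assumes "\<not> is_diagonal X" and "g > 0"
  shows "(X \<bullet> (g *\<^sub>R mat 1)) / (norm X * norm (g *\<^sub>R (mat 1 :: complex ^ 'k ^ 'k))) < 1"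
proof -
  let ?G = "g *\<^sub>R (mat 1 :: complex ^ 'k ^ 'k)"
  have "X \<bullet> ?G \<noteq> norm X * norm ?G"
  proof
    assume "X \<bullet> ?G = norm X * norm ?G"
    then have eq: "norm X *\<^sub>R ?G = norm ?G *\<^sub>R X"
      by (simp only: norm_cauchy_schwarz_eq)
    have "?G \<noteq> 0"
      using \<open>g > 0\<close> by (simp add: vec_eq_iff mat_def)
    \<comment> \<open>Off the diagonal \<open>?G\<close> vanishes, and the nonzero factor
      \<open>norm ?G\<close> cancels.\<close>
    have "X $ i $ j = 0" if "i \<noteq> j" for i j
    proof -
      have "norm ?G *\<^sub>R X $ i $ j = norm X *\<^sub>R ?G $ i $ j"
        using eq by (metis vector_scaleR_component)
      then show ?thesis
        using that \<open>?G \<noteq> 0\<close> by (simp add: mat_def)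
    qed
    with assms show False
      by (simp add: is_diagonal_def)
  qed
  then have "X \<bullet> ?G < norm X * norm ?G"
    using norm_cauchy_schwarz [of X ?G] by linarith
  \<comment> \<open>A zero denominator would give the quotient 0, which is also below 1, so it is
    enough that the norms are nonnegative.\<close>
  then show ?thesis
    by (smt (verit) divide_less_eq_1 mult_nonneg_nonneg norm_ge_zero)
qed

text \<open>The similarities are complex by definition, so they are shown to lie in
  \<open>\<real>\<close> and compared through \<open>Re\<close>. For orthogonal signatures all three
  are 0; strictness is therefore claimed only for a nonzero
  \<open>herm_inner (sig n) (sig n')\<close>.\<close>

theorem proposition1:
  fixes lam :: real and Lm :: nat and sd :: "nat \<Rightarrow> real" and r :: "nat \<Rightarrow> real ^ 'k"
    and sig :: "'dev \<Rightarrow> complex ^ 'l"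
    and chFF chNN chNF :: "'dev \<Rightarrow> channel"
    and n n' :: 'dev
  defines "Xi \<equiv> channel_cov lam Lm sd r"
  defines "rhoFF \<equiv> rho (Xi (chFF n)) (sig n) (Xi (chFF n')) (sig n')"
    and "rhoNN \<equiv> rho (Xi (chNN n)) (sig n) (Xi (chNN n')) (sig n')"
    and "rhoNF \<equiv> rho (Xi (chNF n)) (sig n) (Xi (chNF n')) (sig n')"
  assumes "lam > 0"
    and "inj sig"
    and "\<And>q. q \<in> {n, n'} \<Longrightarrow>
           admissible lam Lm sd r (chFF q) \<and> admissible lam Lm sd r (chNN q) \<and>
           admissible lam Lm sd r (chNF q)"
    and "is_far (chFF n)" and "is_far (chFF n')"
    and "is_near (chNN n)" and "is_near (chNN n')"
    and "(is_near (chNF n) \<and> is_far (chNF n')) \<or> (is_far (chNF n) \<and> is_near (chNF n'))"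
  shows "rhoFF \<in> \<real> \<and> rhoNN \<in> \<real> \<and> rhoNF \<in> \<real> \<and>
         Re rhoNN \<le> Re rhoFF \<and>
         Re rhoNF \<le> Re rhoFF \<and>
         (herm_inner (sig n) (sig n') \<noteq> 0 \<longrightarrow> Re rhoNF < Re rhoFF)"
proof -
  let ?cos = "\<lambda>ch. (Xi (ch n) \<bullet> Xi (ch n')) / (norm (Xi (ch n)) * norm (Xi (ch n')))"
  define c where
    "c = (cmod (herm_inner (sig n) (sig n')) / (norm (sig n) * norm (sig n')))\<^sup>2"
  have rho: "rho (Xi (ch n)) (sig n) (Xi (ch n')) (sig n') = complex_of_real (?cos ch * c)" for ch
    unfolding c_def Xi_def by (intro rho_hermitian hermitian_channel_cov)
  have "c \<ge> 0"
    by (simp add: c_def)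
  have c_pos: "c > 0" if "herm_inner (sig n) (sig n') \<noteq> 0"
  proof -
    \<comment> \<open>A zero signature would make the inner product 0; hence the denominator in
      \<open>c\<close> is positive too.\<close>
    have "sig n \<noteq> 0" "sig n' \<noteq> 0"
      using that by (auto simp: herm_inner_def)
    with that show ?thesis
      by (simp add: c_def)
  qed
  have adm: "admissible lam Lm sd r (chFF q)" "admissible lam Lm sd r (chNF q)"
    if "q \<in> {n, n'}" for q
    using assms(7) that by auto
  have FF: "?cos chFF = 1"
  proof -
    obtain g g' where ch: "chFF n = Far_Field g" "chFF n' = Far_Field g'"
      using assms(8,9) by (metis channel.collapse(1))
    have "(mat 1 :: complex ^ 'k ^ 'k) \<noteq> 0"
      by (simp add: vec_eq_iff mat_def)
    then show ?thesis
      using adm(1) [of n] adm(1) [of n'] unfolding Xi_def ch channel_cov.simps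
      by (intro real_cosine_scaleR) auto
  qed
  have NF: "?cos chNF < 1"
    using assms(12)
  proof (elim disjE conjE)
    assume "is_near (chNF n)" "is_far (chNF n')"
    then obtain b g where ch: "chNF n = Near_Field b" "chNF n' = Far_Field g"
      by (metis channel.collapse)
    have "\<not> is_diagonal (Xi (chNF n))" "g > 0" and eq: "Xi (chNF n') = g *\<^sub>R mat 1"
      using adm(2) [of n] adm(2) [of n'] by (auto simp: ch Xi_def)
    then show ?thesis
      unfolding eq by (intro real_cosine_mat_1_less_1)
  next
    assume "is_far (chNF n)" "is_near (chNF n')"
    then obtain b g where ch: "chNF n = Far_Field g" "chNF n' = Near_Field b"
      by (metis channel.collapse)
    have "\<not> is_diagonal (Xi (chNF n'))" "g > 0" and eq: "Xi (chNF n) = g *\<^sub>R mat 1"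
      using adm(2) [of n] adm(2) [of n'] by (auto simp: ch Xi_def)
    then show ?thesis
      unfolding eq
      \<comment> \<open>The cosine is symmetric, which reduces this case to the one with the
        near-field matrix first.\<close>
      by (subst inner_commute, subst mult.commute) (intro real_cosine_mat_1_less_1)
  qed
  have "?cos chNN * c \<le> ?cos chFF * c"
    unfolding FF by (intro mult_right_mono real_cosine_le_1 \<open>c \<ge> 0\<close>)
  moreover have "?cos chNF * c \<le> ?cos chFF * c"
    unfolding FF by (intro mult_right_mono real_cosine_le_1 \<open>c \<ge> 0\<close>)
  moreover have "?cos chNF * c < ?cos chFF * c" if "herm_inner (sig n) (sig n') \<noteq> 0"
    unfolding FF by (intro mult_strict_right_mono NF c_pos that)
  ultimately show ?thesis
    unfolding rhoFF_def rhoNN_def rhoNF_def rho Re_complex_of_real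
    by (intro conjI impI Reals_of_real)
qed

end
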